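(* For every integer $n\ge0$ let $$P_n=P_n(q)=\sum_{j\ge0}\sum_{k\ge0}(-1)^kq^{2j^2+k}\begin{bmatrix} 2j+k-1\\ k\end{bmatrix}_{q}\begin{bmatrix} n-j-k\\ j\end{bmatrix}_{q^2}.$$ Then $$P_n=\sum_{j=-\infty}^\infty(-1)^jq^{j(7j+1)/2}\begin{bmatrix} n\\ \left\lfloor\frac{2n+7j+2}{4}\right\rfloor\end{bmatrix}_{q^2},$$ and $P_0=P_1=1$, $P_2=q^2+1$, and $P_n=(1-q-q^2)P_{n-1}+(q^{2n-2}-q^3+q^2+q)P_{n-2}+q^3P_{n-3}$ for $n\ge3$.
   Context: $q$ is an indeterminate. $(a;p)_n=\prod_{i=0}^{n-1}(1-ap^i)$. The Gaussian polynomial in base $p$ is $\begin{bmatrix} A\\ B\end{bmatrix}_{p}=\frac{(p;p)_A}{(p;p)_B(p;p)_{A-B}}$ if $0\le B\le A$, and $0$ otherwise; the only exception is that the factor $\begin{bmatrix} 2j+k-1\\ k\end{bmatrix}_{q}$ is taken to be $1$ when $j=k=0$. All sums have only finitely many nonzero terms. *)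

theory Defs
  imports
    "HOL-Computational_Algebra.Polynomial"
    "HOL-Computational_Algebra.Fraction_Field"
    "HOL-Library.Groups_Big_Fun"
begin

(* The indeterminate q, as an element of the field Z(q) of rational functions, where the
   quotients defining Gaussian polynomials and the negative powers of -1 are available. *)
definition q :: "int poly fract" where
  "q = Fract [:0, 1:] 1"

definition qpoch :: "'a::field \<Rightarrow> 'a \<Rightarrow> nat \<Rightarrow> 'a" where
  "qpoch a p n = (\<Prod>i<n. 1 - a * p ^ i)"

definition gauss :: "int \<Rightarrow> int \<Rightarrow> 'a::field \<Rightarrow> 'a" where
  "gauss A B p =
     (if 0 \<le> B \<and> B \<le> A
      then qpoch p p (nat A) / (qpoch p p (nat B) * qpoch p p (nat (A - B)))
      else 0)"

(* The exceptional factor: [2j+k-1, k] at j = k = 0 would be [-1, 0] = 0, but is read as 1. *)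
definition gauss_exc :: "nat \<Rightarrow> nat \<Rightarrow> int poly fract" where
  "gauss_exc j k = (if j = 0 \<and> k = 0 then 1 else gauss (2 * int j + int k - 1) (int k) q)"

(* Sum_any is the sum of a finitely supported function and is 0 on infinite support;
   the three finiteness lemmas below rule out the latter case for the sums used here. *)
definition P_term :: "nat \<Rightarrow> nat \<Rightarrow> nat \<Rightarrow> int poly fract" where
  "P_term n j k =
     (-1) ^ k * q ^ (2 * j\<^sup>2 + k) * gauss_exc j k * gauss (int n - int j - int k) (int j) (q\<^sup>2)"

definition P :: "nat \<Rightarrow> int poly fract" where
  "P n = Sum_any (\<lambda>j. Sum_any (\<lambda>k. P_term n j k))"

lemma P_term_eq_0:
  assumes "n < j \<or> n < k"
  shows "P_term n j k = 0"
  using assms by (cases "j = 0") (auto simp: P_term_def gauss_exc_def gauss_def)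

lemma finite_P_term_inner: "finite {k. P_term n j k \<noteq> 0}"
  by (rule finite_subset[of _ "{..n}"]) (use P_term_eq_0 in \<open>auto simp: not_less[symmetric]\<close>)

lemma finite_P_term_outer: "finite {j. Sum_any (\<lambda>k. P_term n j k) \<noteq> 0}"
proof (rule finite_subset[of _ "{..n}"])
  show "{j. Sum_any (\<lambda>k. P_term n j k) \<noteq> 0} \<subseteq> {..n}"
  proof
    fix j assume j: "j \<in> {j. Sum_any (\<lambda>k. P_term n j k) \<noteq> 0}"
    show "j \<in> {..n}"
    proof (rule ccontr)
      assume "j \<notin> {..n}"
      then have "(\<lambda>k. P_term n j k) = (\<lambda>k. 0)"
        by (auto simp: P_term_eq_0)
      with j show False by simp
    qed
  qed
qed simp

(* For integers, div rounds down, so div 4 is the floor of the quotient; j * (7 * j + 1) is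
   always even and nonnegative, so div 2 is exact. *)
lemma finite_bilateral:
  "finite {j::int. (-1) powi j * q powi (j * (7 * j + 1) div 2) *
                   gauss (int n) ((2 * int n + 7 * j + 2) div 4) (q\<^sup>2) \<noteq> 0}"
  by (rule finite_subset[of _ "{- int n - 2..int n + 2}"]) (auto simp: gauss_def split: if_splits)

end

theory Submission
  imports Defs "HOL-Computational_Algebra.Formal_Power_Series"
begin

text \<open>
  Both sides satisfy the same recurrence of order three and agree at \<open>n = 0, 1, 2\<close>.

  For the double sum, fix \<open>j\<close> and sum over \<open>n\<close> and \<open>k\<close>. By the \<open>q\<close>-binomial
  expansion of a reciprocal product, in base \<open>q^2\<close> and in base \<open>q\<close>, the generating function of the part of \<open>P\<^sub>n\<close> belonging to \<open>j\<close> is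
  \<open>t\<^sub>j(x) = q^(2j^2) x^(2j) / ((x;q^2)\<^sub>j\<^sub>+\<^sub>1 (-xq;q)\<^sub>2\<^sub>j)\<close>.
  Replacing \<open>x\<close> by \<open>q^2 x\<close> removes factors from the front of both denominators, which gives
  \<open>(1-x)(1+qx)(1+q^2x) t\<^sub>j\<^sub>+\<^sub>1(x) = q^2 x^2 t\<^sub>j(q^2 x)\<close> (lemma \<open>slice_gf_Suc\<close>). The
  coefficients of this equation, summed over \<open>j\<close>, are the recurrence: the cubic on the left contributes the
  constant coefficients, and the dilation on the right contributes the \<open>q^(2n-2)\<close>.

  For the bilateral sum the recurrence is proved by creative telescoping. Applied to the summand
  with index \<open>j\<close>, the recurrence operator yields a difference
  \<open>G(j+1) - G(j)\<close> (lemma \<open>bilateral_term_telescopes\<close>), and \<open>G\<close> vanishes for large \<open>|j|\<close>. The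
  floor \<open>m = \<lfloor>(2n+7j+2)/4\<rfloor>\<close> is handled by writing \<open>2n+7j+2 = 4m+r\<close>: stepping \<open>j\<close> by one
  shifts \<open>m\<close> by 1 or 2 and moves \<open>r\<close> to \<open>r+3\<close> modulo 4, so that \<open>G\<close> is given by four expressions,
  one for each \<open>r\<close>. Each is a short combination of neighbouring Gaussian polynomials with
  polynomial coefficients, and checking it uses only Pascal's rule and the ratio of two
  neighbouring Gaussian polynomials.
\<close>

section \<open>Gaussian polynomials\<close>

lemma qpoch_Suc: "qpoch a p (Suc n) = qpoch a p n * (1 - a * p ^ n)"
  by (simp add: qpoch_def)

lemma qpoch_0 [simp]: "qpoch a p 0 = 1"
  by (simp add: qpoch_def)

context
  fixes p :: "'a::field"
  assumes not_root: "\<And>k. k > 0 \<Longrightarrow> p ^ k \<noteq> 1"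
begin

lemma qpoch_nonzero: "qpoch p p n \<noteq> 0"
proof (induction n)
  case (Suc n)
  then show ?case using not_root[of "Suc n"] by (simp add: qpoch_Suc)
qed simp

lemma gauss_eq:
  "gauss (int b + int d) (int b) p = qpoch p p (b + d) / (qpoch p p b * qpoch p p d)"
proof -
  have "nat (int b + int d) = b + d" by simp
  then show ?thesis by (simp add: gauss_def)
qed

lemma gauss_0 [simp]: "A \<ge> 0 \<Longrightarrow> gauss A 0 p = 1"
  using qpoch_nonzero by (simp add: gauss_def)

lemma gauss_same [simp]: "A \<ge> 0 \<Longrightarrow> gauss A A p = 1"
  using qpoch_nonzero by (simp add: gauss_def)

text \<open>
  The upper entry must be nonnegative: for \<open>A = B = -1\<close> the left side is 1 and the right side 0.
  The lower entry is arbitrary, so that no boundary cases arise when the rule is used on sums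
  over all integers.\<close>

lemma gauss_pascal:
  assumes "A \<ge> 0"
  shows "gauss (A + 1) (B + 1) p = gauss A B p + p powi (B + 1) * gauss A (B + 1) p"
proof (cases "0 \<le> B \<and> B < A")
  case True
  define b d where "b = nat B" and "d = nat (A - B - 1)"
  have B: "B = int b" and A: "A = int b + int (Suc d)" "A = int (Suc b) + int d"
      "A + 1 = int (Suc b) + int (Suc d)" and B1: "B + 1 = int (Suc b)"
    using True by (auto simp: b_def d_def)
  have 1: "gauss (A + 1) (B + 1) p = qpoch p p (Suc b + Suc d) / (qpoch p p (Suc b) * qpoch p p (Suc d))"
    unfolding A(3) B1 by (rule gauss_eq)
  have 2: "gauss A B p = qpoch p p (b + Suc d) / (qpoch p p b * qpoch p p (Suc d))"
    unfolding A(1) B by (rule gauss_eq)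
  have 3: "gauss A (B + 1) p = qpoch p p (Suc b + d) / (qpoch p p (Suc b) * qpoch p p d)"
    unfolding A(2) B1 by (rule gauss_eq)
  have nz: "1 - p * p ^ b \<noteq> 0" "1 - p * p ^ d \<noteq> 0"
    using not_root[of "Suc b"] not_root[of "Suc d"] by auto
  have "p powi (B + 1) = p ^ Suc b"
    unfolding B1 by (rule power_int_of_nat)
  then show ?thesis
    unfolding 1 2 3 using nz qpoch_nonzero[of b] qpoch_nonzero[of d]
    by (simp add: qpoch_Suc divide_simps) (simp add: algebra_simps power_add)
next
  case False
  then consider "B + 1 < 0" | "B + 1 = 0" | "B = A" | "B > A" by linarith
  then show ?thesis
  proof cases
    case 2
    then show ?thesis using assms by (simp add: gauss_def[of _ B])
  next
    case 3
    then show ?thesis using assms by (simp add: gauss_def[of A "A + 1"])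
  qed (use assms in \<open>auto simp: gauss_def\<close>)
qed

text \<open>
  The ratio of two neighbours in a row, cleared of denominators. In this form it persists
  outside the row: for \<open>B = -1\<close> and \<open>B = A\<close> the factor that multiplies the nonzero entry vanishes.\<close>

lemma gauss_contiguous:
  assumes "A \<ge> 0"
  shows "(1 - p powi (B + 1)) * gauss A (B + 1) p = (1 - p powi (A - B)) * gauss A B p"
proof (cases "0 \<le> B \<and> B < A")
  case True
  define b d where "b = nat B" and "d = nat (A - B - 1)"
  have B: "B = int b" and A: "A = int b + int (Suc d)" "A = int (Suc b) + int d" and B1: "B + 1 = int (Suc b)"
    and AB: "A - B = int (Suc d)"
    using True by (auto simp: b_def d_def)
  have 2: "gauss A B p = qpoch p p (b + Suc d) / (qpoch p p b * qpoch p p (Suc d))"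
    unfolding A(1) B by (rule gauss_eq)
  have 3: "gauss A (B + 1) p = qpoch p p (Suc b + d) / (qpoch p p (Suc b) * qpoch p p d)"
    unfolding A(2) B1 by (rule gauss_eq)
  have nz: "1 - p * p ^ b \<noteq> 0" "1 - p * p ^ d \<noteq> 0"
    using not_root[of "Suc b"] not_root[of "Suc d"] by auto
  have "p powi (B + 1) = p ^ Suc b" "p powi (A - B) = p ^ Suc d"
    unfolding B1 AB by (rule power_int_of_nat)+
  then show ?thesis
    unfolding 2 3 using nz qpoch_nonzero[of b] qpoch_nonzero[of d]
    by (simp add: qpoch_Suc divide_simps)
next
  case False
  then consider "B + 1 < 0" | "B + 1 = 0" | "B = A" | "B > A" by linarith
  then show ?thesis
    by cases (use assms in \<open>auto simp: gauss_def\<close>)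
qed

lemma gauss_pascal_alt:
  assumes "A \<ge> 0"
  shows "gauss (A + 1) (B + 1) p = gauss A (B + 1) p + p powi (A - B) * gauss A B p"
  using gauss_pascal[OF assms, of B] gauss_contiguous[OF assms, of B] by (simp add: algebra_simps)

end

lemma q_power: "q ^ k = Fract (monom 1 k) 1"
proof (induction k)
  case 0
  then show ?case by (simp add: One_fract_def)
next
  case (Suc k)
  have "q ^ Suc k = Fract ([:0, 1:] * monom 1 k) 1"
    by (simp add: Suc) (simp add: q_def)
  also have "[:0, 1:] * monom 1 k = (monom 1 (Suc k) :: int poly)"
    by (simp add: monom_Suc)
  finally show ?case .
qed

text \<open>
  Divisions by \<open>qpoch\<close> are harmless because no positive power of the indeterminate is 1.\<close>

lemma q_not_root: "k > 0 \<Longrightarrow> q ^ k \<noteq> 1"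
  by (simp add: q_power One_fract_def eq_fract monom_eq_1_iff)

lemma q2_not_root: "k > 0 \<Longrightarrow> (q\<^sup>2) ^ k \<noteq> 1"
  using q_not_root[of "2 * k"] by (simp add: power_mult)

lemma q_nonzero: "q \<noteq> 0"
  by (simp add: q_def Zero_fract_def eq_fract)


section \<open>A recurrence for the double sum\<close>

unbundle fps_syntax

text \<open>The substitution of \<open>c x\<close> for \<open>x\<close>.\<close>

definition dilate :: "'a \<Rightarrow> 'a::field fps \<Rightarrow> 'a fps" where
  "dilate c f = Abs_fps (\<lambda>n. c ^ n * f $ n)"

lemma dilate_nth [simp]: "dilate c f $ n = c ^ n * f $ n"
  by (simp add: dilate_def)

lemma dilate_mult: "dilate c (f * g) = dilate c f * dilate c g"
proof -
  have "dilate c h = h oo (fps_const c * fps_X)" for h :: "'a fps"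
    by (simp add: dilate_def fps_compose_linear)
  then show ?thesis by (simp add: fps_compose_mult_distrib)
qed

text \<open>
  This is the expansion of \<open>1 / (x;q^2)\<^sub>j\<^sub>+\<^sub>1\<close>; the lemma \<open>inv_poch_sq_gf_Suc\<close> is the
  corresponding functional equation.\<close>

definition inv_poch_sq_gf :: "nat \<Rightarrow> int poly fract fps" where
  "inv_poch_sq_gf j = Abs_fps (\<lambda>n. gauss (int n + int j) (int j) (q\<^sup>2))"

text \<open>
  This is the expansion of \<open>1 / (-xq;q)\<^sub>i\<close>. For \<open>i = 0\<close> the value is 1, which is the reason for
  the exceptional convention about the entry \<open>k = 0\<close>.\<close>

definition inv_poch_neg_gf :: "nat \<Rightarrow> int poly fract fps" where
  "inv_poch_neg_gf i = Abs_fps (\<lambda>k. (-q) ^ k *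
     (if i = 0 \<and> k = 0 then 1 else gauss (int i + int k - 1) (int k) q))"

text \<open>
  The part of the generating function of \<open>P\<close> that belongs to a fixed \<open>j\<close>. Since
  \<open>1 / (x;q^2)\<^sub>j\<^sub>+\<^sub>1\<close> expands with \<open>[n + j, j]\<close>, the factor \<open>x^(2j)\<close> together with the \<open>x^k\<close> of
  the other series turns the upper entry into \<open>n - j - k\<close>.\<close>

definition slice_gf :: "nat \<Rightarrow> int poly fract fps" where
  "slice_gf j = fps_const (q ^ (2 * j\<^sup>2)) * fps_X ^ (2 * j) * (inv_poch_neg_gf (2 * j) * inv_poch_sq_gf j)"

lemma inv_poch_sq_gf_Suc: "(1 - fps_X) * inv_poch_sq_gf (Suc j) = dilate (q\<^sup>2) (inv_poch_sq_gf j)"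
proof (rule fps_ext)
  fix n
  show "((1 - fps_X) * inv_poch_sq_gf (Suc j)) $ n = dilate (q\<^sup>2) (inv_poch_sq_gf j) $ n"
  proof (cases n)
    case 0
    then show ?thesis using gauss_same[OF q2_not_root] by (simp add: inv_poch_sq_gf_def)
  next
    case (Suc m)
    have "gauss (int m + int j + 1 + 1) (int j + 1) (q\<^sup>2)
        = gauss (int m + int j + 1) (int j + 1) (q\<^sup>2)
          + (q\<^sup>2) ^ Suc m * gauss (int m + int j + 1) (int j) (q\<^sup>2)"
      using gauss_pascal_alt[OF q2_not_root, of "int m + int j + 1" "int j"]
        power_int_of_nat[of "q\<^sup>2" "Suc m"] by (simp add: ac_simps)
    then show ?thesis
      by (simp add: Suc inv_poch_sq_gf_def left_diff_distrib ac_simps)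
  qed
qed

lemma inv_poch_neg_gf_Suc: "(1 + fps_const q * fps_X) * inv_poch_neg_gf (Suc i) = dilate q (inv_poch_neg_gf i)"
proof (rule fps_ext)
  fix n
  show "((1 + fps_const q * fps_X) * inv_poch_neg_gf (Suc i)) $ n = dilate q (inv_poch_neg_gf i) $ n"
  proof (cases n)
    case 0
    then show ?thesis using gauss_0[OF q_not_root] by (simp add: inv_poch_neg_gf_def)
  next
    case (Suc k)
    have "gauss (int i + int k + 1) (int k + 1) q
        = gauss (int i + int k) (int k) q + q ^ Suc k * gauss (int i + int k) (int k + 1) q"
      using gauss_pascal[OF q_not_root, of "int i + int k" "int k"]
        power_int_of_nat[of "q" "Suc k"] by (simp add: ac_simps)
    then show ?thesis
      by (simp add: Suc inv_poch_neg_gf_def distrib_right mult.assoc) (simp add: algebra_simps)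
  qed
qed

text \<open>
  Two steps are needed because the length \<open>2j\<close> of the product grows by two with \<open>j\<close>; each step
  removes one factor and dilates by \<open>q\<close>.\<close>

lemma inv_poch_neg_gf_Suc_Suc:
  "(1 + fps_const (q\<^sup>2) * fps_X) * ((1 + fps_const q * fps_X) * inv_poch_neg_gf (Suc (Suc i)))
   = dilate (q\<^sup>2) (inv_poch_neg_gf i)"
proof -
  have 1: "1 + fps_const (q\<^sup>2) * fps_X = dilate q (1 + fps_const q * fps_X)"
    by (rule fps_ext) (simp add: power2_eq_square fps_X_def)
  have 2: "dilate q (dilate q f) = dilate (q\<^sup>2) f" for f :: "int poly fract fps"
    by (rule fps_ext) (simp add: power2_eq_square power_mult_distrib)
  show ?thesis
    unfolding inv_poch_neg_gf_Suc 1 dilate_mult[symmetric] 2 ..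
qed

text \<open>
  The remaining powers match as well: dilating \<open>x^(2j)\<close> by \<open>q^2\<close> produces \<open>q^(4j)\<close>, and
  \<open>2(j+1)^2 = 2j^2 + 4j + 2\<close>.\<close>

lemma slice_gf_Suc:
  "(1 - fps_X) * ((1 + fps_const (q\<^sup>2) * fps_X) * (1 + fps_const q * fps_X)) * slice_gf (Suc j)
   = fps_const (q\<^sup>2) * fps_X ^ 2 * dilate (q\<^sup>2) (slice_gf j)"
proof -
  define C where "C = fps_const (q ^ (2 * (Suc j)\<^sup>2)) * fps_X ^ (2 * Suc j)"
  have X: "dilate (q\<^sup>2) (fps_const (q ^ (2 * j\<^sup>2)) * fps_X ^ (2 * j))
    = fps_const (q ^ (2 * j\<^sup>2) * q ^ (4 * j)) * fps_X ^ (2 * j)"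
    by (rule fps_ext) (simp add: power_mult[symmetric] fps_X_power_nth)
  have C: "C = fps_const (q\<^sup>2) * fps_X ^ 2 * dilate (q\<^sup>2) (fps_const (q ^ (2 * j\<^sup>2)) * fps_X ^ (2 * j))"
  proof -
    have e: "2 * (Suc j)\<^sup>2 = 2 + 2 * j\<^sup>2 + 4 * j"
      by (simp add: power2_eq_square)
    have "fps_const (q ^ (2 * (Suc j)\<^sup>2)) = fps_const (q\<^sup>2) * fps_const (q ^ (2 * j\<^sup>2) * q ^ (4 * j))"
      unfolding e power_add by (simp only: fps_const_mult mult.assoc)
    moreover have "fps_X ^ (2 * Suc j) = fps_X ^ 2 * (fps_X ^ (2 * j) :: int poly fract fps)"
      by (simp add: power2_eq_square)
    ultimately show ?thesis unfolding X C_def by (simp only: ac_simps)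
  qed
  have "(1 - fps_X) * ((1 + fps_const (q\<^sup>2) * fps_X) * (1 + fps_const q * fps_X)) * slice_gf (Suc j)
    = C * (((1 + fps_const (q\<^sup>2) * fps_X) * ((1 + fps_const q * fps_X) * inv_poch_neg_gf (Suc (Suc (2 * j)))))
      * ((1 - fps_X) * inv_poch_sq_gf (Suc j)))"
    unfolding slice_gf_def C_def by (simp only: ac_simps mult_Suc_right) simp
  also have "\<dots> = C * (dilate (q\<^sup>2) (inv_poch_neg_gf (2 * j)) * dilate (q\<^sup>2) (inv_poch_sq_gf j))"
    unfolding inv_poch_neg_gf_Suc_Suc inv_poch_sq_gf_Suc ..
  also have "\<dots> = fps_const (q\<^sup>2) * fps_X ^ 2 * dilate (q\<^sup>2) (slice_gf j)"
    unfolding C slice_gf_def dilate_mult by (simp only: ac_simps)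
  finally show ?thesis .
qed

text \<open>
  The coefficient of \<open>x^(n+3)\<close> in the functional equation, with the cubic expanded as
  \<open>1 - (1-q-q^2)x - (q^2+q-q^3)x^2 - q^3x^3\<close>.\<close>

lemma slice_gf_recurrence:
  "slice_gf (Suc j) $ (n + 3) = (1 - q - q\<^sup>2) * slice_gf (Suc j) $ (n + 2)
     + (q\<^sup>2 + q - q ^ 3) * slice_gf (Suc j) $ (n + 1) + q ^ 3 * slice_gf (Suc j) $ n
     + q ^ (2 * n + 4) * slice_gf j $ (n + 1)"
proof -
  define f where "f = slice_gf (Suc j)"
  have "(1 - fps_X) * ((1 + fps_const (q\<^sup>2) * fps_X) * (1 + fps_const q * fps_X)) * f
    = f - fps_X * (fps_const (1 - q - q\<^sup>2) * f) - fps_X ^ 2 * (fps_const (q\<^sup>2 + q - q ^ 3) * f)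
        - fps_X ^ 3 * (fps_const (q ^ 3) * f)"
    by (simp add: algebra_simps power2_eq_square power3_eq_cube flip: fps_const_add fps_const_sub fps_const_mult)
  then have "f - fps_X * (fps_const (1 - q - q\<^sup>2) * f) - fps_X ^ 2 * (fps_const (q\<^sup>2 + q - q ^ 3) * f)
        - fps_X ^ 3 * (fps_const (q ^ 3) * f)
    = fps_X ^ 2 * (fps_const (q\<^sup>2) * dilate (q\<^sup>2) (slice_gf j))"
    using slice_gf_Suc[of j] by (simp add: f_def ac_simps)
  from arg_cong[OF this, of "\<lambda>f. f $ (n + 3)"]
  have "f $ (n + 3) - (1 - q - q\<^sup>2) * f $ (n + 2) - (q\<^sup>2 + q - q ^ 3) * f $ (n + 1) - q ^ 3 * f $ n
    = q\<^sup>2 * ((q\<^sup>2) ^ (n + 1) * slice_gf j $ (n + 1))"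
    by (simp add: fps_X_power_mult_nth)
  moreover have "q\<^sup>2 * (q\<^sup>2) ^ (n + 1) = q ^ (2 * n + 4)"
  proof -
    have "2 * n + 4 = 2 + 2 * (n + 1)" by simp
    then show ?thesis by (simp only: power_add power_mult)
  qed
  ultimately show ?thesis
    unfolding f_def by (simp add: algebra_simps)
qed

lemma slice_gf_nth: "slice_gf j $ n = Sum_any (\<lambda>k. P_term n j k)"
proof -
  have e: "gauss_exc j k = (if 2 * j = 0 \<and> k = 0 then 1 else gauss (int (2 * j) + int k - 1) (int k) q)" for k
    by (simp add: gauss_exc_def)
  show ?thesis
  proof (cases "2 * j \<le> n")
    case True
    have "Sum_any (\<lambda>k. P_term n j k) = (\<Sum>k\<in>{0..n - 2 * j}. P_term n j k)"
    proof (rule Sum_any.expand_superset)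
      show "{k. P_term n j k \<noteq> 0} \<subseteq> {0..n - 2 * j}"
        by (auto simp: P_term_def gauss_def split: if_splits)
    qed simp
    also have "\<dots> = (\<Sum>k\<in>{0..n - 2 * j}. q ^ (2 * j\<^sup>2) * (inv_poch_neg_gf (2 * j) $ k * inv_poch_sq_gf j $ (n - 2 * j - k)))"
    proof (rule sum.cong)
      fix k assume "k \<in> {0..n - 2 * j}"
      then have "int (n - 2 * j - k) + int j = int n - int j - int k"
        using True by auto
      then have 1: "inv_poch_sq_gf j $ (n - 2 * j - k) = gauss (int n - int j - int k) (int j) (q\<^sup>2)"
        by (simp only: inv_poch_sq_gf_def fps_nth_Abs_fps)
      have 2: "inv_poch_neg_gf (2 * j) $ k = (-q) ^ k * gauss_exc j k"
        by (simp add: inv_poch_neg_gf_def e)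
      show "P_term n j k = q ^ (2 * j\<^sup>2) * (inv_poch_neg_gf (2 * j) $ k * inv_poch_sq_gf j $ (n - 2 * j - k))"
        unfolding 1 2 P_term_def power_add power_minus[of q k] by (simp only: ac_simps)
    qed simp
    also have "\<dots> = slice_gf j $ n"
      using True unfolding slice_gf_def mult.assoc fps_mult_left_const_nth fps_X_power_mult_nth
      by (simp add: fps_mult_nth sum_distrib_left)
    finally show ?thesis ..
  next
    case False
    then have "P_term n j k = 0" for k
      by (simp add: P_term_def gauss_def)
    with False show ?thesis
      unfolding slice_gf_def mult.assoc fps_mult_left_const_nth fps_X_power_mult_nth by simp
  qed
qed

lemma slice_gf_0: "slice_gf 0 $ n = 1"
proof -
  have "P_term n 0 k = (if k = 0 then 1 else 0)" for k
    using gauss_0[OF q2_not_root, of "int n"] by (simp add: P_term_def gauss_exc_def gauss_def[of _ "int k"])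
  then show ?thesis
    by (simp add: slice_gf_nth)
qed

lemma P_eq_sum:
  assumes "n \<le> L"
  shows "P n = (\<Sum>j\<le>L. slice_gf j $ n)"
  unfolding P_def slice_gf_nth[symmetric]
proof (rule Sum_any.expand_superset)
  show "{j. slice_gf j $ n \<noteq> 0} \<subseteq> {..L}"
  proof
    fix j assume "j \<in> {j. slice_gf j $ n \<noteq> 0}"
    then have "P_term n j \<noteq> (\<lambda>k. 0)"
      by (auto simp: slice_gf_nth)
    then have "j \<le> n"
      using P_term_eq_0[of n j] by (meson ext leI)
    then show "j \<in> {..L}"
      using assms by simp
  qed
qed simp

text \<open>
  The slice \<open>j = 0\<close> is \<open>1/(1-x)\<close>, with all coefficients 1. It is annihilated by the operator with
  constant coefficients, since those coefficients add up to 1; the other slices telescope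
  into \<open>P (n + 1)\<close> through their predecessors.\<close>

lemma P_recurrence:
  "P (n + 3) = (1 - q - q\<^sup>2) * P (n + 2)
     + (q ^ (2 * n + 4) - q ^ 3 + q\<^sup>2 + q) * P (n + 1) + q ^ 3 * P n"
proof -
  define S where "S i = (\<Sum>j\<le>n + 3. slice_gf (Suc j) $ i)" for i
  have P: "P i = 1 + S i" if "i \<le> n + 4" for i
  proof -
    have "P i = (\<Sum>j\<le>Suc (n + 3). slice_gf j $ i)"
      using that by (intro P_eq_sum) simp
    then show ?thesis
      unfolding S_def sum.atMost_Suc_shift by (simp only: slice_gf_0)
  qed
  have "S (n + 3) = (1 - q - q\<^sup>2) * S (n + 2) + (q\<^sup>2 + q - q ^ 3) * S (n + 1) + q ^ 3 * S n
      + q ^ (2 * n + 4) * (\<Sum>j\<le>n + 3. slice_gf j $ (n + 1))"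
    unfolding S_def slice_gf_recurrence by (simp add: sum.distrib sum_distrib_left)
  also have "(\<Sum>j\<le>n + 3. slice_gf j $ (n + 1)) = P (n + 1)"
    by (rule P_eq_sum[symmetric]) simp
  finally show ?thesis
    by (simp add: P algebra_simps)
qed

lemma P_initial: "P 0 = 1" "P 1 = 1" "P 2 = q\<^sup>2 + 1"
proof -
  note nth = slice_gf_def mult.assoc fps_mult_left_const_nth fps_X_power_mult_nth
  have "slice_gf 1 $ 1 = 0" "slice_gf 2 $ 2 = 0"
    unfolding nth by simp_all
  moreover have "slice_gf 1 $ 2 = q\<^sup>2"
    unfolding nth using gauss_0[OF q_not_root, of 1] gauss_same[OF q2_not_root, of 1]
    by (simp add: inv_poch_neg_gf_def inv_poch_sq_gf_def)
  moreover have "{..1::nat} = {0, 1}" "{..2::nat} = {0, 1, 2}"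
    by auto
  ultimately show "P 0 = 1" "P 1 = 1" "P 2 = q\<^sup>2 + 1"
    using P_eq_sum[of 0 0] P_eq_sum[of 1 1] P_eq_sum[of 2 2] by (simp_all add: slice_gf_0)
qed

section \<open>The same recurrence for the bilateral sum\<close>

text \<open>
  The four expressions were obtained by solving linear equations: \<open>G\<close> was written as an unknown
  combination of the entries in row \<open>N = n - 3\<close> at positions \<open>b = m - 3\<close> and above,
  with coefficients that are Laurent polynomials in \<open>q^(2b)\<close> and \<open>q^(2N)\<close>. Here
  \<open>x\<close> stands for \<open>q^(2b)\<close>, \<open>z\<close> for \<open>q^(2N)\<close>, and \<open>h i\<close> for the entry at position \<open>b + i\<close>. A common
  factor \<open>y = q^(2(N-b))\<close> has been taken out, which makes the coefficients polynomials.\<close>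

definition certificate :: "int \<Rightarrow> int poly fract \<Rightarrow> int poly fract \<Rightarrow> (nat \<Rightarrow> int poly fract) \<Rightarrow> int poly fract" where
  "certificate r x z h =
    (if r = 0 then - (q + q^2) * h 0 - q^3 * x * h 1
     else if r = 1 then - (q + q^2) * h 0 - (q^3 + q^4) * x * h 1
     else if r = 2 then - h 0 - (q + z) * h 1 - (q^2 * x - q^6 * x^2) * h 2
     else - h 0 - (q + z) * h 1 - ((q^2 + q^4) * x - q^6 * x^2) * h 2)"

text \<open>
  The local identity behind the telescoping, for entries \<open>h\<close> that satisfy the neighbour relations
  of a row. The quantities \<open>a2, b2, b3, c3\<close> are what Pascal's rule makes of the
  entries one, two and three rows below, expressed in row \<open>N\<close>. Since the identity is linear in
  \<open>h\<close>, it is a combination of the neighbour relations; the multipliers in the four cases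
  come from eliminating \<open>h 0, h 1, h 2, \<dots>\<close> in this order.\<close>

lemma certificate_identity:
  fixes x y :: "int poly fract" and h :: "nat \<Rightarrow> int poly fract"
  assumes con: "\<And>k. (q ^ (2 * k) - x * q ^ (4 * k + 2)) * h (Suc k) = (q ^ (2 * k) - y) * h k"
    and r: "r = 0 \<or> r = 1 \<or> r = 2 \<or> r = (3 :: int)"
  defines "a2 \<equiv> h 1 + x * q^4 * h 2"
  defines "b2 \<equiv> h 0 + x * q^2 * h 1 + x * q^4 * a2"
    and "b3 \<equiv> a2 + x * q^6 * (h 2 + x * q^6 * h 3)"
  defines "c3 \<equiv> b2 + x * q^6 * b3"
    and "s \<equiv> (if r = 0 then 1 else 2 :: nat)"
  shows "c3 - (1 - q - q^2) * (if r < 2 then b2 else b3) - (q^4 * (x * y) - q^3 + q^2 + q) * a2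
      - q^3 * (if r < 2 then h 1 else h 2)
    = - (x * q ^ (nat r + 8 - 2 * s)) * certificate ((r + 3) mod 4) (x * q ^ (2 * s)) (x * y) (\<lambda>i. h (s + i))
      - y * certificate r x (x * y) h"
proof -
  have con0: "(1 - x * q^2) * h 1 = (1 - y) * h 0"
    and con1: "(q^2 - x * q^6) * h 2 = (q^2 - y) * h 1"
    and con2: "(q^4 - x * q^10) * h 3 = (q^4 - y) * h 2"
    and con3: "(q^6 - x * q^14) * h 4 = (q^6 - y) * h 3"
    using con[of 0] con[of 1] con[of 2] con[of 3] by (simp_all add: eval_nat_numeral)
  from r show ?thesis
  proof (elim disjE)
    assume r: "r = 0"
    have "(q + q^2) * ((1 - y) * h 0 - (1 - x * q^2) * h 1)
        + x * (q^3 + q^4) * ((q^2 - y) * h 1 - (q^2 - x * q^6) * h 2)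
        + x^2 * (q^6 + q^8) * ((q^4 - y) * h 2 - (q^4 - x * q^10) * h 3) = 0"
      unfolding con0 con1 con2 by simp
    then have "c3 - (1 - q - q^2) * b2 - (q^4 * (x * y) - q^3 + q^2 + q) * a2 - q^3 * h 1
      = - (x * q^6) * (- h 1 - (q + x * y) * h 2 - ((q^2 + q^4) * (x*q^2) - q^6 * (x*q^2)^2) * h 3)
        - y * (- (q + q^2) * h 0 - q^3 * x * h 1)"
      unfolding a2_def b2_def b3_def c3_def by algebra
    then show ?thesis unfolding r s_def by (simp add: certificate_def eval_nat_numeral)
  next
    assume r: "r = 1"
    have "(q + q^2) * ((1 - y) * h 0 - (1 - x * q^2) * h 1)
        + x * (q^3 + 2*q^4) * ((q^2 - y) * h 1 - (q^2 - x * q^6) * h 2)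
        + x^2 * q^8 * ((q^4 - y) * h 2 - (q^4 - x * q^10) * h 3) = 0"
      unfolding con0 con1 con2 by simp
    then have "c3 - (1 - q - q^2) * b2 - (q^4 * (x * y) - q^3 + q^2 + q) * a2 - q^3 * h 1
      = - (x * q^5) * (- (q + q^2) * h 2 - q^3 * (x*q^4) * h 3)
        - y * (- (q + q^2) * h 0 - (q^3+q^4) * x * h 1)"
      unfolding a2_def b2_def b3_def c3_def by algebra
    then show ?thesis unfolding r s_def by (simp add: certificate_def eval_nat_numeral)
  next
    assume r: "r = 2"
    have "((1 - y) * h 0 - (1 - x * q^2) * h 1)
        + (x * y + q + x * q^2 + x * q^4) * ((q^2 - y) * h 1 - (q^2 - x * q^6) * h 2)
        + x^2 * q^8 * ((q^4 - y) * h 2 - (q^4 - x * q^10) * h 3) = 0"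
      unfolding con0 con1 con2 by simp
    then have "c3 - (1 - q - q^2) * b3 - (q^4 * (x * y) - q^3 + q^2 + q) * a2 - q^3 * h 2
      = - (x * q^6) * (- (q + q^2) * h 2 - (q^3+q^4) * (x*q^4) * h 3)
        - y * (- h 0 - (q + x * y) * h 1 - (q^2 * x - q^6 * x^2) * h 2)"
      unfolding a2_def b2_def b3_def c3_def by algebra
    then show ?thesis unfolding r s_def by (simp add: certificate_def eval_nat_numeral)
  next
    assume r: "r = 3"
    have "((1 - y) * h 0 - (1 - x * q^2) * h 1)
        + (x * y + q + x * q^2 + x * q^4) * ((q^2 - y) * h 1 - (q^2 - x * q^6) * h 2)
        + (x * q^4 + x^2 * q^8) * ((q^4 - y) * h 2 - (q^4 - x * q^10) * h 3)
        + x^2 * q^7 * ((q^6 - y) * h 3 - (q^6 - x * q^14) * h 4) = 0"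
      unfolding con0 con1 con2 con3 by simp
    then have "c3 - (1 - q - q^2) * b3 - (q^4 * (x * y) - q^3 + q^2 + q) * a2 - q^3 * h 2
      = - (x * q^7) * (- h 2 - (q + x * y) * h 3 - (q^2 * (x*q^4) - q^6 * (x*q^4)^2) * h 4)
        - y * (- h 0 - (q + x * y) * h 1 - ((q^2 + q^4) * x - q^6 * x^2) * h 2)"
      unfolding a2_def b2_def b3_def c3_def by algebra
    then show ?thesis unfolding r s_def by (simp add: certificate_def eval_nat_numeral)
  qed
qed

definition weight :: "int \<Rightarrow> int poly fract" where
  "weight j = (-1) powi j * q powi (j * (7 * j + 1) div 2)"

definition bilateral_term :: "nat \<Rightarrow> int \<Rightarrow> int poly fract" where
  "bilateral_term n j = weight j * gauss (int n) ((2 * int n + 7 * j + 2) div 4) (q\<^sup>2)"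

text \<open>
  The row is \<open>N\<close> while the recurrence is read at \<open>n = N + 3\<close>. Thus
  \<open>2n + 7j + 2 = 2N + 7j + 8\<close>, whose quotient by 4 exceeds that of \<open>2N + 7j\<close> by 2, and the position
  \<open>b = m - 3\<close> is one less than the latter quotient.\<close>

definition antidifference :: "nat \<Rightarrow> int \<Rightarrow> int poly fract" where
  "antidifference N j =
    (let b = (2 * int N + 7 * j) div 4 - 1 in
     weight j * (q\<^sup>2) powi (int N - b) *
     certificate ((2 * int N + 7 * j) mod 4) ((q\<^sup>2) powi b) ((q\<^sup>2) ^ N) (\<lambda>i. gauss (int N) (b + int i) (q\<^sup>2)))"

lemma weight_Suc: "weight (j + 1) = - (q powi (7 * j + 4)) * weight j"
proof -
  have "(j + 1) * (7 * (j + 1) + 1) = j * (7 * j + 1) + 2 * (7 * j + 4)"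
    by (simp add: algebra_simps)
  then have "(j + 1) * (7 * (j + 1) + 1) div 2 = (7 * j + 4) + j * (7 * j + 1) div 2"
    by simp
  then show ?thesis
    unfolding weight_def using q_nonzero by (simp add: power_int_add)
qed

lemma bilateral_term_telescopes:
  "bilateral_term (N + 3) j - (1 - q - q\<^sup>2) * bilateral_term (N + 2) j
     - (q ^ (2 * N + 4) - q ^ 3 + q\<^sup>2 + q) * bilateral_term (N + 1) j - q ^ 3 * bilateral_term N j
   = antidifference N (j + 1) - antidifference N j"
proof -
  define r where "r = (2 * int N + 7 * j) mod 4"
  define b where "b = (2 * int N + 7 * j) div 4 - 1"
  define s where "s = (if r = 0 then 1 else 2 :: nat)"
  have r: "r = 0 \<or> r = 1 \<or> r = 2 \<or> r = 3"
    unfolding r_def by presburger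
  have br: "2 * int N + 7 * j = 4 * b + 4 + r"
    unfolding r_def b_def by presburger
  define x y where "x = (q\<^sup>2) powi b" and "y = (q\<^sup>2) powi (int N - b)"
  define h where "h i = gauss (int N) (b + int i) (q\<^sup>2)" for i
  have q0: "q \<noteq> 0" "q\<^sup>2 \<noteq> 0" using q_nonzero by auto
  have xy: "x * y = (q\<^sup>2) ^ N"
    using q0 by (simp add: x_def y_def flip: power_int_add)
  have xs: "(q\<^sup>2) powi (b + int k) = x * q ^ (2 * k)" for k
    using q0 by (simp add: x_def power_int_add power_mult)
  have ys: "q ^ (2 * k) * (q\<^sup>2) powi (int N - (b + int k)) = y" for k
    using q0 by (simp add: y_def power_int_diff power_int_add power_mult)
  have pas: "gauss (int (Suc A)) (b + int (Suc k)) (q\<^sup>2)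
      = gauss (int A) (b + int k) (q\<^sup>2) + x * q ^ (2 * Suc k) * gauss (int A) (b + int (Suc k)) (q\<^sup>2)" for A k
    using gauss_pascal[OF q2_not_root, of "int A" "b + int k"] xs[of "Suc k"] by (simp add: ac_simps)
  have con: "(q ^ (2 * k) - x * q ^ (4 * k + 2)) * h (Suc k) = (q ^ (2 * k) - y) * h k" for k
  proof -
    have "(q\<^sup>2) powi (b + int k + 1) = x * q ^ (2 * Suc k)"
      using xs[of "Suc k"] by (simp add: ac_simps)
    then have "q ^ (2 * k) * ((1 - x * q ^ (2 * Suc k)) * h (Suc k))
        = q ^ (2 * k) * ((1 - (q\<^sup>2) powi (int N - (b + int k))) * h k)"
      using gauss_contiguous[OF q2_not_root, of "int N" "b + int k"]
      by (simp add: h_def ac_simps)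
    also have "\<dots> = (q ^ (2 * k) - y) * h k"
      using ys[of k] by (simp add: algebra_simps)
    finally show ?thesis
      by (simp add: algebra_simps flip: power_add)
  qed
  have a1: "gauss (int (N + 1)) (b + 1) (q\<^sup>2) = h 0 + x * q^2 * h 1"
    and a2: "gauss (int (N + 1)) (b + 2) (q\<^sup>2) = h 1 + x * q^4 * h 2"
    and a3: "gauss (int (N + 1)) (b + 3) (q\<^sup>2) = h 2 + x * q^6 * h 3"
    using pas[of N 0] pas[of N 1] pas[of N 2] by (simp_all add: h_def eval_nat_numeral)
  have b2: "gauss (int (N + 2)) (b + 2) (q\<^sup>2) = h 0 + x * q^2 * h 1 + x * q^4 * (h 1 + x * q^4 * h 2)"
    and b3: "gauss (int (N + 2)) (b + 3) (q\<^sup>2) = h 1 + x * q^4 * h 2 + x * q^6 * (h 2 + x * q^6 * h 3)"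
    using pas[of "N + 1" 1] pas[of "N + 1" 2] a1 a2 a3 by (simp_all add: eval_nat_numeral)
  have c3: "gauss (int (N + 3)) (b + 3) (q\<^sup>2) = h 0 + x * q^2 * h 1 + x * q^4 * (h 1 + x * q^4 * h 2)
      + x * q^6 * (h 1 + x * q^4 * h 2 + x * q^6 * (h 2 + x * q^6 * h 3))"
    using pas[of "N + 2" 2] b2 b3 by (simp add: eval_nat_numeral)
  \<comment> \<open>Where the floors land: lowering \<open>n\<close> by one lowers \<open>r\<close> by 2 and borrows from \<open>m\<close>
    exactly if \<open>r < 2\<close>; raising \<open>j\<close> by one adds 7 to \<open>4m + r\<close>.\<close>
  have i3: "(2 * int (N + 3) + 7 * j + 2) div 4 = b + 3"
    and i2: "(2 * int (N + 2) + 7 * j + 2) div 4 = (if r < 2 then b + 2 else b + 3)"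
    and i1: "(2 * int (N + 1) + 7 * j + 2) div 4 = b + 2"
    and i0: "(2 * int N + 7 * j + 2) div 4 = (if r < 2 then b + 1 else b + 2)"
    and j1: "(2 * int N + 7 * (j + 1)) div 4 - 1 = b + int s"
    using r br by (auto simp: s_def)
  have j2: "(2 * int N + 7 * (j + 1)) mod 4 = (r + 3) mod 4"
    using br by presburger
  have q4: "q ^ (2 * N + 4) = q ^ 4 * (x * y)"
    unfolding xy by (simp add: power_add power_mult)
  \<comment> \<open>By \<open>7j + 4 = 4b - 2N + r + 8\<close> the quotient of consecutive weights is \<open>-(x/y) q^(r+8)\<close>;
    the factor \<open>y\<close> taken out of the certificate absorbs the denominator.\<close>
  have Wy: "weight (j + 1) * (q\<^sup>2) powi (int N - (b + int s))
      = weight j * - (x * q ^ (nat r + 8 - 2 * s))"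
  proof -
    have qq: "(q\<^sup>2) powi k = q powi (2 * k)" for k
      by (simp add: power_int_mult)
    have "int (nat r + 8 - 2 * s) = r + 8 - 2 * int s"
      using r by (auto simp: s_def)
    then have "(7 * j + 4) + 2 * (int N - (b + int s)) = 2 * b + int (nat r + 8 - 2 * s)"
      using br by simp
    then have "q powi (7 * j + 4) * q powi (2 * (int N - (b + int s)))
        = q powi (2 * b) * q ^ (nat r + 8 - 2 * s)"
      using q0 by (metis power_int_add power_int_of_nat)
    then show ?thesis
      unfolding weight_Suc qq x_def by simp
  qed
  have A1: "antidifference N (j + 1) = weight j * (- (x * q ^ (nat r + 8 - 2 * s)) *
      certificate ((r + 3) mod 4) (x * q ^ (2 * s)) (x * y) (\<lambda>i. h (s + i)))"
    unfolding antidifference_def j1 j2 Let_def Wy xs xy h_def by (simp add: ac_simps)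
  have A0: "antidifference N j = weight j * (y * certificate r x (x * y) h)"
    unfolding antidifference_def Let_def r_def[symmetric] b_def[symmetric] xy[symmetric]
      x_def[symmetric] y_def[symmetric] h_def
    by (simp add: mult.assoc)
  have "bilateral_term (N + 3) j - (1 - q - q\<^sup>2) * bilateral_term (N + 2) j
     - (q ^ (2 * N + 4) - q ^ 3 + q\<^sup>2 + q) * bilateral_term (N + 1) j - q ^ 3 * bilateral_term N j
     = weight j * (gauss (int (N + 3)) (b + 3) (q\<^sup>2)
       - (1 - q - q\<^sup>2) * (if r < 2 then gauss (int (N + 2)) (b + 2) (q\<^sup>2) else gauss (int (N + 2)) (b + 3) (q\<^sup>2))
       - (q^4 * (x * y) - q^3 + q^2 + q) * gauss (int (N + 1)) (b + 2) (q\<^sup>2)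
       - q^3 * (if r < 2 then h 1 else h 2))"
    unfolding bilateral_term_def i3 i2 i1 i0 q4 by (simp add: h_def algebra_simps)
  also have "\<dots> = weight j * (- (x * q ^ (nat r + 8 - 2 * s)) *
      certificate ((r + 3) mod 4) (x * q ^ (2 * s)) (x * y) (\<lambda>i. h (s + i)) - y * certificate r x (x * y) h)"
    unfolding c3 b2 b3 a2 s_def
    by (rule arg_cong[where f = "\<lambda>t. weight j * t"], rule certificate_identity[OF con r])
  also have "\<dots> = antidifference N (j + 1) - antidifference N j"
    unfolding A0 A1 by (simp add: right_diff_distrib)
  finally show ?thesis .
qed

definition bilateral_sum :: "nat \<Rightarrow> int poly fract" where
  "bilateral_sum n = Sum_any (bilateral_term n)"

lemma bilateral_sum_eq_sum:
  assumes "n \<le> L"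
  shows "bilateral_sum n = (\<Sum>j\<in>{- int L - 2..<int L + 3}. bilateral_term n j)"
  unfolding bilateral_sum_def
  by (rule Sum_any.expand_superset)
    (use assms in \<open>auto simp: bilateral_term_def gauss_def split: if_splits\<close>)

text \<open>
  All three positions used by the certificate lie outside row \<open>N\<close>.\<close>

lemma antidifference_eq_0:
  assumes "j \<le> - int N - 4 \<or> j \<ge> int N + 4"
  shows "antidifference N j = 0"
proof -
  define b where "b = (2 * int N + 7 * j) div 4 - 1"
  have "b + 2 < 0 \<or> b > int N"
    using assms unfolding b_def by auto
  then have "gauss (int N) b (q\<^sup>2) = 0" "gauss (int N) (b + 1) (q\<^sup>2) = 0"
      "gauss (int N) (b + 2) (q\<^sup>2) = 0"
    by (auto simp: gauss_def)
  then show ?thesis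
    unfolding antidifference_def Let_def b_def[symmetric] by (simp add: certificate_def)
qed

lemma sum_telescope_int:
  fixes f :: "int \<Rightarrow> 'a::ab_group_add"
  assumes "a \<le> b"
  shows "(\<Sum>j\<in>{a..<b}. f (j + 1) - f j) = f b - f a"
  using assms
proof (induction rule: int_ge_induct)
  case (step i)
  have "{a..<i + 1} = insert i {a..<i}" using step by auto
  with step show ?case by simp
qed simp

lemma bilateral_sum_recurrence:
  "bilateral_sum (n + 3) = (1 - q - q\<^sup>2) * bilateral_sum (n + 2)
     + (q ^ (2 * n + 4) - q ^ 3 + q\<^sup>2 + q) * bilateral_sum (n + 1) + q ^ 3 * bilateral_sum n"
proof -
  define I where "I = {- int (n + 3) - 2..<int (n + 3) + 3}"
  have B: "bilateral_sum i = (\<Sum>j\<in>I. bilateral_term i j)" if "i \<le> n + 3" for i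
    unfolding I_def using that by (rule bilateral_sum_eq_sum)
  have "bilateral_sum (n + 3) - (1 - q - q\<^sup>2) * bilateral_sum (n + 2)
      - (q ^ (2 * n + 4) - q ^ 3 + q\<^sup>2 + q) * bilateral_sum (n + 1) - q ^ 3 * bilateral_sum n
    = (\<Sum>j\<in>I. bilateral_term (n + 3) j - (1 - q - q\<^sup>2) * bilateral_term (n + 2) j
      - (q ^ (2 * n + 4) - q ^ 3 + q\<^sup>2 + q) * bilateral_term (n + 1) j - q ^ 3 * bilateral_term n j)"
    by (simp add: B sum_subtractf sum_distrib_left)
  also have "\<dots> = antidifference n (int (n + 3) + 3) - antidifference n (- int (n + 3) - 2)"
    unfolding bilateral_term_telescopes I_def by (rule sum_telescope_int) simp
  also have "\<dots> = 0"
    by (simp add: antidifference_eq_0)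
  finally show ?thesis
    by (simp add: algebra_simps)
qed

lemma bilateral_sum_initial: "bilateral_sum 0 = 1" "bilateral_sum 1 = 1" "bilateral_sum 2 = q\<^sup>2 + 1"
proof -
  have single: "bilateral_sum n = bilateral_term n 0" if "n \<le> 2" for n
  proof -
    have "bilateral_sum n = (\<Sum>j\<in>{0}. bilateral_term n j)"
      unfolding bilateral_sum_def
      by (rule Sum_any.expand_superset)
        (use that in \<open>auto simp: bilateral_term_def gauss_def split: if_splits\<close>)
    then show ?thesis by simp
  qed
  have two: "gauss 2 1 (q\<^sup>2) = q\<^sup>2 + 1"
    using gauss_pascal[OF q2_not_root, of 1 0]
      gauss_0[OF q2_not_root, of 1] gauss_same[OF q2_not_root, of 1] by simp
  have "weight 0 = 1"
    by (simp add: weight_def)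
  then show "bilateral_sum 0 = 1" "bilateral_sum 1 = 1" "bilateral_sum 2 = q\<^sup>2 + 1"
    using two gauss_same[OF q2_not_root, of 0] gauss_same[OF q2_not_root, of 1]
    by (simp_all add: single bilateral_term_def)
qed

lemma P_eq_bilateral_sum: "P n = bilateral_sum n"
proof (induction n rule: less_induct)
  case (less n)
  have "n = 0 \<or> n = 1 \<or> n = 2 \<or> (\<exists>m. n = m + 3)"
    by presburger
  then consider "n = 0" | "n = 1" | "n = 2" | m where "n = m + 3"
    by blast
  then show ?case
  proof cases
    case 4
    then show ?thesis
      by (simp only: P_recurrence bilateral_sum_recurrence less.IH)
  qed (simp_all only: P_initial bilateral_sum_initial)
qed

theorem mainTheorem11:
  shows "(\<forall>n. P n = Sum_any (\<lambda>j::int. (-1) powi j * q powi (j * (7 * j + 1) div 2) *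
                      gauss (int n) ((2 * int n + 7 * j + 2) div 4) (q\<^sup>2))) \<and>
         P 0 = 1 \<and> P 1 = 1 \<and> P 2 = q\<^sup>2 + 1 \<and>
         (\<forall>n\<ge>3. P n = (1 - q - q\<^sup>2) * P (n - 1)
                     + (q ^ (2 * n - 2) - q ^ 3 + q\<^sup>2 + q) * P (n - 2)
                     + q ^ 3 * P (n - 3))"
proof (intro conjI allI impI)
  fix n :: nat
  show "P n = Sum_any (\<lambda>j::int. (-1) powi j * q powi (j * (7 * j + 1) div 2) *
                      gauss (int n) ((2 * int n + 7 * j + 2) div 4) (q\<^sup>2))"
    unfolding P_eq_bilateral_sum bilateral_sum_def bilateral_term_def weight_def ..
next
  fix n :: nat
  assume "3 \<le> n"
  then obtain m where n: "n = m + 3"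
    using le_Suc_ex by (metis add.commute)
  have "m + 3 - 1 = m + 2" "m + 3 - 2 = m + 1" "m + 3 - 3 = m" "2 * (m + 3) - 2 = 2 * m + 4"
    by simp_all
  then show "P n = (1 - q - q\<^sup>2) * P (n - 1)
      + (q ^ (2 * n - 2) - q ^ 3 + q\<^sup>2 + q) * P (n - 2) + q ^ 3 * P (n - 3)"
    unfolding n by (simp only: P_recurrence)
qed (rule P_initial)+

end
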